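(* Let $n, q, M, r$ be positive integers with $q\ge 2$. Assume that there exists a uniform collection $(C_0,\ldots,C_{M-1})$ of $M$ perfect $r$-colorings of $H(n,q)$, all with the same set of colors $K$ ($|K|=r$) and the same quotient matrix $S$, and assume that the first coloring $C_0$ essentially depends on all of its $n$ arguments. Assume also that there exists a perfect $Mq$-coloring $E$ of $H(M,q)$, with color set $\{0,1,\ldots,Mq-1\}$ and quotient matrix $T=(T_{i,j})$, where $$T_{i,j}=\begin{cases}0, & \text{if } i\equiv j \bmod q,\\ 1, & \text{if } i\not\equiv j \bmod q.\end{cases}$$ Then there exists a uniform collection of $M$ perfect $r$-colorings of $H(qn+M,q)$, each with color set $K$ and quotient matrix $$S+(q-1)^2 n\, I+(q-1)M\,P,$$ where $I$ is the $r\times r$ identity matrix and $P$ is the $r\times r$ matrix each of whose rows is the density vector corresponding to $S$ (that is, $P_{k,t}=\rho(t)$ for all $k,t\in K$), such that each coloring of this collection essentially depends on all of its $qn+M$ arguments.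
   Context: The Hamming graph $H(n,q)$ ($n\ge 1$, $q\ge 2$) is the graph on the set $\Sigma^n$ of words of length $n$ over an alphabet $\Sigma$ of size $q$, two words being adjacent if and only if they differ in exactly one position. A $k$-coloring of a graph is a surjective function from its vertex set onto a finite set $K$ of $k$ colors. A $k$-coloring is perfect if there is a $k\times k$ matrix $(S_{i,j})_{i,j\in K}$ (the quotient matrix) such that every vertex of color $i$ has exactly $S_{i,j}$ neighbors of color $j$, for all $i,j\in K$. A function $f$ on the vertices of $H(n,q)$ essentially depends on its $i$th argument if there are two vertices $\bar x,\bar y$ differing in only the $i$th position such that $f(\bar x)\ne f(\bar y)$. A collection $(C_0,\ldots,C_{M-1})$ of colorings of $H(n,q)$ (repetitions allowed) is uniform if the multiset of colors $\{C_0(\bar x),\ldots,C_{M-1}(\bar x)\}$ does not depend on the vertex $\bar x$ of $H(n,q)$. The density $\rho(i)$ of color $i$ in a coloring of a finite graph is the proportion of vertices of color $i$ among all vertices; the density vector is the list of densities of all colors. For a perfect coloring of $H(n,q)$ the density vector is uniquely determined by the quotient matrix, because $\rho(i)S_{i,j}=\rho(j)S_{j,i}$; this is "the density vector corresponding to $S$". *)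

theory Defs
  imports Complex_Main "HOL-Library.Multiset"
begin

text \<open>
  A graph is given by its vertex set \<open>V\<close> and its adjacency relation \<open>adj\<close>.
\<close>

definition coloring :: "'v set \<Rightarrow> 'c set \<Rightarrow> ('v \<Rightarrow> 'c) \<Rightarrow> bool" where
  "coloring V K C \<longleftrightarrow> finite K \<and> C ` V = K"

text \<open>
  Quotient matrices have real entries, and only their entries indexed by \<open>K\<close> matter.
\<close>

definition perfect_coloring ::
    "'v set \<Rightarrow> ('v \<Rightarrow> 'v \<Rightarrow> bool) \<Rightarrow> 'c set \<Rightarrow> ('c \<Rightarrow> 'c \<Rightarrow> real) \<Rightarrow> ('v \<Rightarrow> 'c) \<Rightarrow> bool" where
  "perfect_coloring V adj K S C \<longleftrightarrow>
     coloring V K C \<and>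
     (\<forall>x\<in>V. \<forall>j\<in>K. real (card {y \<in> V. adj x y \<and> C y = j}) = S (C x) j)"

definition density :: "'v set \<Rightarrow> ('v \<Rightarrow> 'c) \<Rightarrow> 'c \<Rightarrow> real" where
  "density V C i = real (card {x \<in> V. C x = i}) / real (card V)"

text \<open>
  The density vector corresponding to \<open>S\<close>. In a finite connected graph, all perfect
  colorings with quotient matrix \<open>S\<close> have the same density \<open>\<rho>\<close>, because
  \<open>\<rho> i * S i j = \<rho> j * S j i\<close>; so the description is proper as soon as one such coloring exists.
\<close>

definition density_vector ::
    "'v set \<Rightarrow> ('v \<Rightarrow> 'v \<Rightarrow> bool) \<Rightarrow> 'c set \<Rightarrow> ('c \<Rightarrow> 'c \<Rightarrow> real) \<Rightarrow> 'c \<Rightarrow> real" where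
  "density_vector V adj K S = (THE \<rho>. \<exists>C. perfect_coloring V adj K S C \<and> \<rho> = density V C)"

text \<open>
  The Hamming graph \<open>H(n,q)\<close> is the graph on \<open>hamming_words n \<Sigma>\<close>, for an alphabet \<open>\<Sigma>\<close> of
  size \<open>q\<close>, with adjacency \<open>hamming_adj\<close>. Positions are numbered from 0.
\<close>

definition hamming_words :: "nat \<Rightarrow> 'a set \<Rightarrow> 'a list set" where
  "hamming_words n \<Sigma> = {x. set x \<subseteq> \<Sigma> \<and> length x = n}"

definition differ_only_at :: "nat \<Rightarrow> 'a list \<Rightarrow> 'a list \<Rightarrow> bool" where
  "differ_only_at i x y \<longleftrightarrow> length x = length y \<and> {j. j < length x \<and> x ! j \<noteq> y ! j} = {i}"

definition hamming_adj :: "'a list \<Rightarrow> 'a list \<Rightarrow> bool" where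
  "hamming_adj x y \<longleftrightarrow> (\<exists>i. differ_only_at i x y)"

definition essentially_depends :: "nat \<Rightarrow> 'a set \<Rightarrow> ('a list \<Rightarrow> 'c) \<Rightarrow> nat \<Rightarrow> bool" where
  "essentially_depends n \<Sigma> f i \<longleftrightarrow>
     (\<exists>x\<in>hamming_words n \<Sigma>. \<exists>y\<in>hamming_words n \<Sigma>. differ_only_at i x y \<and> f x \<noteq> f y)"

definition uniform_collection :: "'v set \<Rightarrow> nat \<Rightarrow> (nat \<Rightarrow> 'v \<Rightarrow> 'c) \<Rightarrow> bool" where
  "uniform_collection V M C \<longleftrightarrow>
     (\<forall>x\<in>V. \<forall>y\<in>V. {# C m x. m \<in># mset_set {..<M} #} = {# C m y. m \<in># mset_set {..<M} #})"

abbreviation hamming_perfect_coloring ::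
    "nat \<Rightarrow> 'a set \<Rightarrow> 'c set \<Rightarrow> ('c \<Rightarrow> 'c \<Rightarrow> real) \<Rightarrow> ('a list \<Rightarrow> 'c) \<Rightarrow> bool" where
  "hamming_perfect_coloring n \<Sigma> \<equiv> perfect_coloring (hamming_words n \<Sigma>) hamming_adj"

end

theory Submission
  imports Defs
begin

text \<open>
  Split a word of length \<open>q * n + M\<close> into \<open>q\<close> blocks of length \<open>n\<close> and a tail of length \<open>M\<close>.
  The color \<open>e\<close> that \<open>E\<close> gives to the tail decides what is read off: \<open>e mod q\<close> selects a block,
  and \<open>e div q\<close> selects, after a cyclic shift by \<open>m\<close>, the coloring from \<open>C\<close> applied to it.
  Changing the selected block contributes \<open>S\<close>, changing another block leaves the color
  unchanged, and changing the tail leads once to each pair of another block and a coloring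
  from \<open>C\<close>; by uniformity the colors seen there are distributed according to the density.
  Since \<open>E\<close> attains every value, any block can be selected together with \<open>C 0\<close>, which gives
  essential dependence on the blocks; a step in the tail always switches to another block,
  whose content is independent of the old one, which gives dependence on the tail.
\<close>

section \<open>The Hamming graph: letter changes, neighbour counts, connectivity\<close>

lemma finite_hamming_words: "finite \<Sigma> \<Longrightarrow> finite (hamming_words n \<Sigma>)"
  unfolding hamming_words_def by (rule finite_lists_length_eq)

lemma length_hamming_words: "x \<in> hamming_words n \<Sigma> \<Longrightarrow> length x = n"
  by (simp add: hamming_words_def)

lemma hamming_words_update:
  "x \<in> hamming_words n \<Sigma> \<Longrightarrow> c \<in> \<Sigma> \<Longrightarrow> x[i := c] \<in> hamming_words n \<Sigma>"
  using set_update_subset_insert[of x i c] by (auto simp: hamming_words_def)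

lemma hamming_words_nth: "x \<in> hamming_words n \<Sigma> \<Longrightarrow> i < n \<Longrightarrow> x ! i \<in> \<Sigma>"
  by (auto simp: hamming_words_def)

lemma differ_only_at_iff:
  "differ_only_at i x y \<longleftrightarrow>
    length y = length x \<and> (\<forall>j. j < length x \<and> x ! j \<noteq> y ! j \<longleftrightarrow> j = i)"
  by (simp only: differ_only_at_def set_eq_iff mem_Collect_eq singleton_iff
      eq_commute[of "length x" "length y"])

lemma differ_only_at_update:
  "i < length x \<Longrightarrow> c \<noteq> x ! i \<Longrightarrow> differ_only_at i x (x[i := c])"
  by (auto simp: differ_only_at_iff nth_list_update)

text \<open>Together with \<open>differ_only_at_update\<close>, this replaces the adjacency relation
  by list updates with a new letter.\<close>

lemma differ_only_atD:
  assumes "differ_only_at i x y"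
  shows "i < length x" "y ! i \<noteq> x ! i" "y = x[i := y ! i]"
proof -
  have len: "length y = length x" and D: "j < length x \<and> x ! j \<noteq> y ! j \<longleftrightarrow> j = i" for j
    using assms by (simp_all only: differ_only_at_iff)
  show "i < length x" "y ! i \<noteq> x ! i"
    using D[of i] by auto
  show "y = x[i := y ! i]"
  proof (rule nth_equalityI)
    fix j assume "j < length y"
    then show "y ! j = x[i := y ! i] ! j"
      using D[of j] len by (cases "j = i") simp_all
  qed (simp add: len)
qed

lemma hamming_adj_sym: "hamming_adj x y \<Longrightarrow> hamming_adj y x"
  unfolding hamming_adj_def differ_only_at_iff by metis

text \<open>Each neighbour arises from exactly one pair of a position and a new letter, so the count
  splits by position. The predicate \<open>P\<close> is kept arbitrary to serve for color conditions
  in \<open>H(n,q)\<close>, in the tail graph \<open>H(M,q)\<close> and in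
  \<open>H(qn+M,q)\<close>.\<close>

lemma card_hamming_neighbours:
  assumes x: "x \<in> hamming_words n \<Sigma>" and fin: "finite \<Sigma>"
  shows "card {y \<in> hamming_words n \<Sigma>. hamming_adj x y \<and> P y}
           = (\<Sum>i<n. card {c \<in> \<Sigma>. c \<noteq> x ! i \<and> P (x[i := c])})"
proof -
  let ?A = "SIGMA i:{..<n}. {c \<in> \<Sigma>. c \<noteq> x ! i \<and> P (x[i := c])}"
  let ?f = "\<lambda>(i, c). x[i := c]"
  have len: "length x = n"
    using x by (rule length_hamming_words)
  have "{y \<in> hamming_words n \<Sigma>. hamming_adj x y \<and> P y} = ?f ` ?A"
  proof (intro subset_antisym subsetI)
    fix y assume y: "y \<in> {y \<in> hamming_words n \<Sigma>. hamming_adj x y \<and> P y}"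
    then obtain i where i: "differ_only_at i x y"
      by (auto simp: hamming_adj_def)
    have "(i, y ! i) \<in> ?A"
      using differ_only_atD[OF i] y len by (auto intro: hamming_words_nth)
    moreover have "y = ?f (i, y ! i)"
      using differ_only_atD(3)[OF i] by simp
    ultimately show "y \<in> ?f ` ?A"
      by blast
  next
    fix y assume "y \<in> ?f ` ?A"
    then show "y \<in> {y \<in> hamming_words n \<Sigma>. hamming_adj x y \<and> P y}"
      using x len by (auto simp: hamming_adj_def intro!: hamming_words_update differ_only_at_update)
  qed
  moreover have "inj_on ?f ?A"
  proof (rule inj_onI, clarsimp)
    fix i c j d
    assume *: "i < n" "j < n" "c \<noteq> x ! i" "d \<noteq> x ! j" "x[i := c] = x[j := d]"
    then show "i = j \<and> c = d"
      by (metis len nth_list_update_eq nth_list_update_neq)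
  qed
  ultimately have "card {y \<in> hamming_words n \<Sigma>. hamming_adj x y \<and> P y} = card ?A"
    by (simp add: card_image)
  also have "\<dots> = (\<Sum>i<n. card {c \<in> \<Sigma>. c \<noteq> x ! i \<and> P (x[i := c])})"
    using fin by (intro card_SigmaI) auto
  finally show ?thesis .
qed

text \<open>Replace the letters of \<open>x\<close> by those of \<open>y\<close> from left to right;
  after \<open>k\<close> replacements the word is \<open>take k y @ drop k x\<close>.\<close>

lemma hamming_connected:
  assumes x: "x \<in> hamming_words n \<Sigma>" and y: "y \<in> hamming_words n \<Sigma>"
  shows "(\<lambda>u v. u \<in> hamming_words n \<Sigma> \<and> v \<in> hamming_words n \<Sigma> \<and> hamming_adj u v)\<^sup>*\<^sup>* x y"
    (is "?R\<^sup>*\<^sup>* x y")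
proof -
  have len: "length x = n" "length y = n"
    using x y by (simp_all add: length_hamming_words)
  have "k \<le> n \<Longrightarrow> take k y @ drop k x \<in> hamming_words n \<Sigma> \<and> ?R\<^sup>*\<^sup>* x (take k y @ drop k x)" for k
  proof (induction k)
    case 0
    then show ?case using x by simp
  next
    case (Suc k)
    let ?z = "take k y @ drop k x"
    have z: "?z \<in> hamming_words n \<Sigma>" "?R\<^sup>*\<^sup>* x ?z"
      using Suc by auto
    have k: "k < n" "length (take k y) = k" "length ?z = n"
      using Suc.prems len by simp_all
    have "?z = take k y @ x ! k # drop (Suc k) x"
      using k len by (simp add: Cons_nth_drop_Suc)
    then have step: "take (Suc k) y @ drop (Suc k) x = ?z[k := y ! k]"
      using k len list_update_length[of "take k y" "x ! k" "drop (Suc k) x" "y ! k"]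
      by (simp add: take_Suc_conv_app_nth)
    have z': "?z[k := y ! k] \<in> hamming_words n \<Sigma>"
      using Suc.prems by (intro hamming_words_update z hamming_words_nth[OF y]) simp
    have "?R\<^sup>*\<^sup>* x (?z[k := y ! k])"
    \<comment> \<open>Where the letters already agree, the update is no edge and the path simply
      stays.\<close>
    proof (cases "y ! k = ?z ! k")
      case True
      then have "?z[k := y ! k] = ?z" by (simp only: list_update_id)
      then show ?thesis using z(2) by (simp only:)
    next
      case False
      then have "hamming_adj ?z (?z[k := y ! k])"
        unfolding hamming_adj_def using k by (intro exI[of _ k] differ_only_at_update) simp_all
      then have "?R ?z (?z[k := y ! k])" using z z' by blast
      with z(2) show ?thesis by (rule rtranclp.rtrancl_into_rtrancl)
    qed
    then show ?case unfolding step using z' by blast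
  qed
  from this[of n] show ?thesis using len by simp
qed

section \<open>Densities of perfect colorings\<close>

lemma detailed_balance:
  assumes fin: "finite V" and sym: "\<And>x y. adj x y \<Longrightarrow> adj y x"
    and pc: "perfect_coloring V adj K S C" and K: "i \<in> K" "j \<in> K"
  shows "density V C i * S i j = density V C j * S j i"
proof -
  \<comment> \<open>Either side counts the adjacent pairs leading from class \<open>a\<close> to
    class \<open>b\<close>; swapping the two sums and using symmetry of \<open>adj\<close> then
    yields the balance.\<close>
  have edges: "real (card {x \<in> V. C x = a}) * S a b
      = (\<Sum>x | x \<in> V \<and> C x = a. \<Sum>y | y \<in> V \<and> C y = b. if adj x y then 1 else 0)"
    if "a \<in> K" "b \<in> K" for a b
  proof -
    have "(\<Sum>y | y \<in> V \<and> C y = b. if adj x y then 1 else 0) = S a b"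
      if "x \<in> V" "C x = a" for x
    proof -
      have "(\<Sum>y | y \<in> V \<and> C y = b. if adj x y then 1 else 0)
          = real (card ({y \<in> V. C y = b} \<inter> {y. adj x y}))"
        using fin by (simp add: sum.If_cases)
      also have "{y \<in> V. C y = b} \<inter> {y. adj x y} = {y \<in> V. adj x y \<and> C y = b}"
        by auto
      finally show ?thesis
        using pc that \<open>b \<in> K\<close> by (simp add: perfect_coloring_def)
    qed
    then show ?thesis by simp
  qed
  have "real (card {x \<in> V. C x = i}) * S i j
      = (\<Sum>x | x \<in> V \<and> C x = i. \<Sum>y | y \<in> V \<and> C y = j. if adj x y then 1 else 0)"
    using K by (rule edges)
  also have "\<dots> = (\<Sum>y | y \<in> V \<and> C y = j. \<Sum>x | x \<in> V \<and> C x = i. if adj x y then 1 else 0)"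
    by (rule sum.swap)
  also have "\<dots> = (\<Sum>y | y \<in> V \<and> C y = j. \<Sum>x | x \<in> V \<and> C x = i. if adj y x then 1 else 0)"
    by (intro sum.cong refl if_cong) (use sym in blast)
  also have "\<dots> = real (card {x \<in> V. C x = j}) * S j i"
    using edges[of j i] K by simp
  finally show ?thesis
    by (simp add: density_def)
qed

lemma density_pos:
  assumes "finite V" "x \<in> V"
  shows "density V C (C x) > 0"
proof -
  have "{y \<in> V. C y = C x} \<noteq> {}" "V \<noteq> {}" using assms by auto
  then show ?thesis
    using assms by (simp add: density_def card_gt_0_iff)
qed

text \<open>Densities are compared as functions on the whole color type, so their values off
  \<open>K\<close> matter too.\<close>

lemma density_outside: "coloring V K C \<Longrightarrow> i \<notin> K \<Longrightarrow> density V C i = 0"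
  by (auto simp: density_def coloring_def card_eq_0_iff)

lemma sum_density:
  assumes "finite V" "V \<noteq> {}" "coloring V K C"
  shows "(\<Sum>i\<in>K. density V C i) = 1"
proof -
  have "(\<Sum>i\<in>K. card {x \<in> V. C x = i}) = (\<Sum>i\<in>K. \<Sum>x | x \<in> V \<and> C x = i. 1)"
    by simp
  also have "\<dots> = (\<Sum>x\<in>V. 1)"
    using assms by (intro sum.group) (auto simp: coloring_def)
  finally have "(\<Sum>i\<in>K. real (card {x \<in> V. C x = i})) = real (card V)"
    by (metis card_eq_sum of_nat_sum)
  then show ?thesis
    using assms by (simp add: density_def flip: sum_divide_distrib)
qed

text \<open>The neighbour \<open>y\<close> is itself counted by this entry. Positivity permits the
  divisions in \<open>density_unique\<close>.\<close>

lemma perfect_coloring_entry_pos: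
  assumes "finite V" "perfect_coloring V adj K S C" "x \<in> V" "y \<in> V" "adj x y"
  shows "S (C x) (C y) > 0"
proof -
  have "{z \<in> V. adj x z \<and> C z = C y} \<noteq> {}" using assms by auto
  then have "card {z \<in> V. adj x z \<and> C z = C y} > 0"
    using assms by (simp add: card_gt_0_iff)
  moreover have "real (card {z \<in> V. adj x z \<and> C z = C y}) = S (C x) (C y)"
    using assms by (auto simp: perfect_coloring_def coloring_def)
  ultimately show ?thesis by linarith
qed

text \<open>Along an edge, detailed balance determines the density of one end color from the other
  through \<open>S\<close> alone. Hence the quotient of the two densities is preserved along edges,
  connectivity makes it constant on \<open>K\<close>, and as both densities sum to 1 it equals
  1.\<close>

lemma density_unique:
  assumes fin: "finite V" and ne: "V \<noteq> {}" and sym: "\<And>x y. adj x y \<Longrightarrow> adj y x"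
    and conn: "\<And>x y. x \<in> V \<Longrightarrow> y \<in> V \<Longrightarrow> (\<lambda>u v. u \<in> V \<and> v \<in> V \<and> adj u v)\<^sup>*\<^sup>* x y"
    and C: "perfect_coloring V adj K S C" and C': "perfect_coloring V adj K S C'"
  shows "density V C' = density V C"
proof -
  let ?\<rho> = "density V C" and ?\<rho>' = "density V C'"
  have col: "coloring V K C" "coloring V K C'" and K: "C ` V = K"
    using C C' by (simp_all add: perfect_coloring_def coloring_def)
  obtain x0 where x0: "x0 \<in> V" using ne by blast
  have pos: "?\<rho> (C x) > 0" if "x \<in> V" for x
    using fin that by (rule density_pos)
  have edge: "?\<rho>' (C x) / ?\<rho> (C x) = ?\<rho>' (C y) / ?\<rho> (C y)"
    if "x \<in> V" "y \<in> V" "adj x y" for x y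
  proof -
    \<comment> \<open>Both entries are seen to be positive from \<open>C\<close>; since
      \<open>S\<close> is shared, they also serve in the balance of \<open>C'\<close>.\<close>
    have S: "S (C x) (C y) > 0" "S (C y) (C x) > 0"
      using perfect_coloring_entry_pos[OF fin C that]
        perfect_coloring_entry_pos[OF fin C that(2,1) sym[OF that(3)]] .
    have in_K: "C x \<in> K" "C y \<in> K" using that K by auto
    have "?\<rho> (C y) = ?\<rho> (C x) * S (C x) (C y) / S (C y) (C x)"
      using detailed_balance[OF fin sym C in_K] S by (simp add: field_simps)
    moreover have "?\<rho>' (C y) = ?\<rho>' (C x) * S (C x) (C y) / S (C y) (C x)"
      using detailed_balance[OF fin sym C' in_K] S by (simp add: field_simps)
    ultimately show ?thesis using S by simp
  qed
  define r where "r = ?\<rho>' (C x0) / ?\<rho> (C x0)"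
  have "?\<rho>' (C x) / ?\<rho> (C x) = r" if "x \<in> V" for x
    using conn[OF x0 that]
  proof (induction rule: rtranclp_induct)
    case base
    show ?case by (simp add: r_def)
  next
    case (step y z)
    then show ?case using edge[of y z] by simp
  qed
  then have ratio: "?\<rho>' i = r * ?\<rho> i" if "i \<in> K" for i
  proof -
    obtain x where "x \<in> V" "i = C x" using \<open>i \<in> K\<close> K by blast
    then show ?thesis
      using pos[of x] \<open>\<And>x. x \<in> V \<Longrightarrow> ?\<rho>' (C x) / ?\<rho> (C x) = r\<close>[of x] by (simp add: field_simps)
  qed
  have "1 = (\<Sum>i\<in>K. ?\<rho>' i)"
    using sum_density[OF fin ne col(2)] by simp
  also have "\<dots> = r * (\<Sum>i\<in>K. ?\<rho> i)"
    by (simp add: ratio sum_distrib_left)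
  also have "\<dots> = r"
    using sum_density[OF fin ne col(1)] by simp
  finally have "r = 1" by simp
  show ?thesis
  proof
    fix i
    show "?\<rho>' i = ?\<rho> i"
      using ratio[of i] \<open>r = 1\<close> density_outside[OF col(1), of i] density_outside[OF col(2), of i]
      by (cases "i \<in> K") simp_all
  qed
qed

text \<open>Uniqueness makes the definite description proper, so any coloring with matrix
  \<open>S\<close> may be used to compute it.\<close>

lemma density_vector_hamming:
  assumes "finite \<Sigma>" "\<Sigma> \<noteq> {}" "hamming_perfect_coloring n \<Sigma> K S C"
  shows "density_vector (hamming_words n \<Sigma>) hamming_adj K S = density (hamming_words n \<Sigma>) C"
proof -
  obtain c where "c \<in> \<Sigma>" using assms by blast
  then have "replicate n c \<in> hamming_words n \<Sigma>"
    by (auto simp: hamming_words_def)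
  then have "hamming_words n \<Sigma> \<noteq> {}" by blast
  then have unique: "density (hamming_words n \<Sigma>) C' = density (hamming_words n \<Sigma>) C"
    if "hamming_perfect_coloring n \<Sigma> K S C'" for C'
    using density_unique[OF finite_hamming_words[OF assms(1)] _ hamming_adj_sym hamming_connected
        assms(3) that] by blast
  show ?thesis
    unfolding density_vector_def
  proof (rule the_equality)
    fix \<rho> assume "\<exists>C'. hamming_perfect_coloring n \<Sigma> K S C' \<and> \<rho> = density (hamming_words n \<Sigma>) C'"
    then show "\<rho> = density (hamming_words n \<Sigma>) C"
      using unique by blast
  qed (use assms(3) in blast)
qed

section \<open>Color counts in uniform collections\<close>

lemma uniform_collection_count:
  assumes "uniform_collection V M C" "x \<in> V" "y \<in> V"
  shows "card {m. m < M \<and> C m x = t} = card {m. m < M \<and> C m y = t}"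
proof -
  have "count {# C m z. m \<in># mset_set {..<M} #} t = card {m. m < M \<and> C m z = t}" for z
  proof -
    have "{m \<in> {..<M}. C m z = t} = {m. m < M \<and> C m z = t}" by auto
    then show ?thesis
      by (simp add: count_image_mset' flip: card_eq_sum) (simp add: conj_commute eq_commute)
  qed
  moreover have "{# C m x. m \<in># mset_set {..<M} #} = {# C m y. m \<in># mset_set {..<M} #}"
    using assms unfolding uniform_collection_def by blast
  ultimately show ?thesis by metis
qed

text \<open>Count the pairs of a vertex and an index showing color \<open>t\<close> in two ways:
  every vertex contributes the same number, and every coloring contributes
  \<open>card V * d\<close>.\<close>

lemma uniform_collection_density:
  assumes fin: "finite V" and U: "uniform_collection V M C"
    and dens: "\<And>m. m < M \<Longrightarrow> density V (C m) t = d" and x: "x \<in> V"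
  shows "real (card {m. m < M \<and> C m x = t}) = real M * d"
proof -
  have cV: "card V > 0" using fin x by (auto simp: card_gt_0_iff)
  have "real (card V) * real (card {m. m < M \<and> C m x = t})
      = (\<Sum>y\<in>V. real (card {m. m < M \<and> C m y = t}))"
    by (simp add: uniform_collection_count[OF U _ x, of _ t])
  also have "\<dots> = (\<Sum>y\<in>V. \<Sum>m<M. if C m y = t then 1 else 0)"
    by (simp add: sum.If_cases Int_def)
  also have "\<dots> = (\<Sum>m<M. \<Sum>y\<in>V. if C m y = t then 1 else 0)"
    by (rule sum.swap)
  also have "\<dots> = (\<Sum>m<M. real (card {y \<in> V. C m y = t}))"
    using fin by (simp add: sum.If_cases Int_def)
  also have "\<dots> = (\<Sum>m<M. real (card V) * d)"
    using dens cV by (intro sum.cong refl) (auto simp: density_def field_simps)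
  finally show ?thesis using cV by simp
qed

section \<open>Cyclic shifts and two-digit indices\<close>

lemma bij_betw_rotate:
  fixes m M :: nat
  shows "bij_betw (\<lambda>a. (m + a) mod M) {..<M} {..<M}"
proof -
  \<comment> \<open>Equal residues force \<open>M dvd b - a\<close>, and the only multiple of
    \<open>M\<close> below \<open>M\<close> is 0. The order \<open>a \<le> b\<close> keeps the
    natural subtraction exact.\<close>
  have le: "a = b" if "(m + a) mod M = (m + b) mod M" "a \<le> b" "b < M" for a b
  proof -
    have "M dvd b - a"
      using that mod_eq_dvd_iff_nat[of "m + a" "m + b" M] by simp
    then show ?thesis
      using that by (cases "b - a = 0") (auto dest: dvd_imp_le)
  qed
  have inj: "inj_on (\<lambda>a. (m + a) mod M) {..<M}"
  proof (rule inj_onI)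
    fix a b assume "a \<in> {..<M}" "b \<in> {..<M}" "(m + a) mod M = (m + b) mod M"
    then show "a = b"
      using le[of a b] le[of b a] by (cases "a \<le> b") auto
  qed
  moreover have "(\<lambda>a. (m + a) mod M) ` {..<M} \<subseteq> {..<M}"
    by auto
  ultimately show ?thesis
    unfolding bij_betw_def using endo_inj_surj[of "{..<M}"] by blast
qed

lemma sum_lessThan_add:
  fixes f :: "nat \<Rightarrow> 'b::comm_monoid_add"
  shows "(\<Sum>i<a + b. f i) = (\<Sum>i<a. f i) + (\<Sum>i<b. f (a + i))"
  by (induction b) (simp_all add: add.assoc)

text \<open>Used for positions, where the high digit is the block and the low digit the place in it,
  and for colors of \<open>E\<close>, where the high digit is the shift and the low digit the
  block.\<close>

lemma sum_lessThan_mult: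
  fixes f :: "nat \<Rightarrow> 'b::comm_monoid_add"
  shows "(\<Sum>i<a * b. f i) = (\<Sum>j<a. \<Sum>i<b. f (j * b + i))"
  by (induction a) (simp_all add: add.commute[of b] sum_lessThan_add)

lemma digits_eq_iff:
  fixes b b' i j n :: nat
  assumes "i < n" "j < n"
  shows "b * n + i = b' * n + j \<longleftrightarrow> b = b' \<and> i = j"
proof -
  have "(b * n + i) div n = b" "(b * n + i) mod n = i" "(b' * n + j) div n = b'" "(b' * n + j) mod n = j"
    using assms by simp_all
  then show ?thesis by metis
qed

lemma digits_bound:
  fixes b q i n :: nat
  assumes "b < q" "i < n"
  shows "b * n + i < q * n"
proof -
  have "b * n + i < Suc b * n" using assms by simp
  also have "\<dots> \<le> q * n" using assms by (intro mult_right_mono) auto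
  finally show ?thesis .
qed

section \<open>Blocks and tail of a long word\<close>

definition block :: "nat \<Rightarrow> 'a list \<Rightarrow> nat \<Rightarrow> 'a list" where
  "block n w b = take n (drop (b * n) w)"

lemma block_bound:
  fixes b q n :: nat
  shows "b < q \<Longrightarrow> b * n + n \<le> q * n"
  using mult_right_mono[of "Suc b" q n] by simp

lemma block_in_hamming_words:
  assumes "w \<in> hamming_words (q * n + M) \<Sigma>" "b < q"
  shows "block n w b \<in> hamming_words n \<Sigma>"
  using assms block_bound[of b q n]
  by (auto simp: hamming_words_def block_def dest!: in_set_takeD in_set_dropD)

lemma tail_in_hamming_words:
  "w \<in> hamming_words (k + M) \<Sigma> \<Longrightarrow> drop k w \<in> hamming_words M \<Sigma>"
  by (auto simp: hamming_words_def dest!: in_set_dropD)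

lemma length_block: "b < q \<Longrightarrow> q * n \<le> length w \<Longrightarrow> length (block n w b) = n"
  using block_bound[of b q n] by (simp add: block_def)

lemma nth_block:
  "b < q \<Longrightarrow> q * n \<le> length w \<Longrightarrow> i < n \<Longrightarrow> block n w b ! i = w ! (b * n + i)"
  using block_bound[of b q n] by (simp add: block_def)

lemma block_update:
  assumes "b < q" "b' < q" "i < n" "q * n \<le> length w"
  shows "block n (w[b * n + i := c]) b' = (if b = b' then (block n w b)[i := c] else block n w b')"
  \<comment> \<open>By uniqueness of digits, the position \<open>b * n + i\<close> lies in block
    \<open>b'\<close> only if the blocks coincide.\<close>
  using assms less_le_trans[OF digits_bound[OF assms(1,3)] assms(4)] digits_eq_iff[of i n _ b b']
  by (intro nth_equalityI) (auto simp: length_block[of _ q] nth_block[of _ q] nth_list_update)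

lemma block_update_tail:
  assumes "b < q"
  shows "block n (w[q * n + i := c]) b = block n w b"
  using block_bound[OF assms, of n] by (simp add: block_def drop_update_swap)

text \<open>Blocks and tail can be prescribed independently; this supplies the words that witness
  surjectivity and essential dependence.\<close>

lemma exists_word:
  assumes f: "\<And>b. b < q \<Longrightarrow> f b \<in> hamming_words n \<Sigma>" and y: "y \<in> hamming_words M \<Sigma>"
  obtains w where "w \<in> hamming_words (q * n + M) \<Sigma>" "drop (q * n) w = y"
    "\<And>b. b < q \<Longrightarrow> block n w b = f b"
proof -
  define w where "w = map (\<lambda>k. f (k div n) ! (k mod n)) [0..<q * n] @ y"
  have lw: "length w = q * n + M"
    using y by (simp add: w_def length_hamming_words)
  have "f (k div n) ! (k mod n) \<in> \<Sigma>" if "k < q * n" for k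
  proof -
    have "n > 0" using that by (cases n) auto
    then show ?thesis
      using that by (intro hamming_words_nth[OF f]) (auto simp: less_mult_imp_div_less)
  qed
  then have "w \<in> hamming_words (q * n + M) \<Sigma>"
    using y lw by (auto simp: hamming_words_def w_def)
  moreover have "drop (q * n) w = y"
    by (simp add: w_def)
  moreover have "block n w b = f b" if "b < q" for b
  proof (rule nth_equalityI)
    show "length (block n w b) = length (f b)"
      using that lw by (simp add: length_block[of _ q] length_hamming_words[OF f])
    fix i assume "i < length (block n w b)"
    then have "i < n"
      using that lw by (simp add: length_block[of _ q])
    then show "block n w b ! i = f b ! i"
      using that lw digits_bound[OF that \<open>i < n\<close>]
      by (simp add: nth_block[of _ q] w_def nth_append)
  qed
  ultimately show ?thesis by (rule that)
qed

section \<open>The switched colorings\<close>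

locale coloring_switch =
  fixes n q M :: nat and \<Sigma> :: "'a set" and K :: "'c set" and S :: "'c \<Rightarrow> 'c \<Rightarrow> real"
    and C :: "nat \<Rightarrow> 'a list \<Rightarrow> 'c" and E :: "'a list \<Rightarrow> nat"
  assumes q: "q \<ge> 2" and M: "M \<ge> 1"
    and fin: "finite \<Sigma>" and card_\<Sigma>: "card \<Sigma> = q"
    and C: "m < M \<Longrightarrow> hamming_perfect_coloring n \<Sigma> K S (C m)"
    and U: "uniform_collection (hamming_words n \<Sigma>) M C"
    and E: "hamming_perfect_coloring M \<Sigma> {0..<M * q}
              (\<lambda>i j. if i mod q = j mod q then 0 else 1) E"
begin

abbreviation \<rho> :: "'c \<Rightarrow> real" where
  "\<rho> \<equiv> density_vector (hamming_words n \<Sigma>) hamming_adj K S"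

text \<open>The tail color \<open>e\<close> is a separate argument so that it can vary while the
  blocks of \<open>w\<close> stay fixed. As \<open>e\<close> runs through the colors of
  \<open>E\<close>, its digits run once through all pairs of a shift and a block.\<close>

definition select :: "nat \<Rightarrow> 'a list \<Rightarrow> nat \<Rightarrow> 'c" where
  "select m w e = C ((m + e div q) mod M) (block n w (e mod q))"

definition switched :: "nat \<Rightarrow> 'a list \<Rightarrow> 'c" where
  "switched m w = select m w (E (drop (q * n) w))"

lemma C_image: "m < M \<Longrightarrow> C m ` hamming_words n \<Sigma> = K"
  using C by (simp add: perfect_coloring_def coloring_def)

lemma C_surj: "m < M \<Longrightarrow> k \<in> K \<Longrightarrow> \<exists>x\<in>hamming_words n \<Sigma>. C m x = k"
  using C_image[of m] by auto

lemma C_in_K: "m < M \<Longrightarrow> x \<in> hamming_words n \<Sigma> \<Longrightarrow> C m x \<in> K"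
  using C_image by blast

lemma C_neighbours:
  assumes "m < M" "x \<in> hamming_words n \<Sigma>" "t \<in> K"
  shows "real (card {y \<in> hamming_words n \<Sigma>. hamming_adj x y \<and> C m y = t}) = S (C m x) t"
  using C[OF assms(1)] assms by (simp add: perfect_coloring_def)

lemma E_image: "E ` hamming_words M \<Sigma> = {0..<M * q}"
  using E by (simp add: perfect_coloring_def coloring_def)

lemma E_neighbours:
  assumes "y \<in> hamming_words M \<Sigma>" "e < M * q"
  shows "card {v \<in> hamming_words M \<Sigma>. hamming_adj y v \<and> E v = e}
    = (if E y mod q = e mod q then 0 else 1)"
proof -
  have "real (card {v \<in> hamming_words M \<Sigma>. hamming_adj y v \<and> E v = e})
      = (if E y mod q = e mod q then 0 else 1)"
    using E assms by (simp add: perfect_coloring_def)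
  then show ?thesis by (simp split: if_splits)
qed

lemma E_mod_less: "E y mod q < q"
  using q by simp

lemma shift_less: "(m + a) mod M < M"
  using M by simp

text \<open>All \<open>C m\<close> share the matrix \<open>S\<close> and hence the density, which is
  what the averaging argument needs.\<close>

lemma uniform_count:
  assumes "x \<in> hamming_words n \<Sigma>"
  shows "real (card {m. m < M \<and> C m x = t}) = real M * \<rho> t"
proof (rule uniform_collection_density[OF _ U _ assms])
  show "finite (hamming_words n \<Sigma>)"
    using fin by (rule finite_hamming_words)
  have "\<Sigma> \<noteq> {}" using card_\<Sigma> q by auto
  then show "density (hamming_words n \<Sigma>) (C m) t = \<rho> t" if "m < M" for m
    using density_vector_hamming[OF fin _ C[OF that]] by simp
qed

lemma uniform_count_shift:
  assumes "x \<in> hamming_words n \<Sigma>"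
  shows "(\<Sum>a<M. if C ((m + a) mod M) x = t then 1 else 0) = real M * \<rho> t"
proof -
  have "(\<Sum>a<M. if C ((m + a) mod M) x = t then 1 else 0)
      = (\<Sum>a<M. if C a x = t then 1 else (0::real))"
    by (rule sum.reindex_bij_betw[OF bij_betw_rotate])
  also have "\<dots> = real (card {a. a < M \<and> C a x = t})"
    by (simp add: sum.If_cases Int_def)
  finally show ?thesis using uniform_count[OF assms] by simp
qed

section \<open>Neighbour counts of the switched colorings\<close>

lemma tail_neighbours:
  assumes w: "w \<in> hamming_words (q * n + M) \<Sigma>"
  shows "real (card {v \<in> hamming_words M \<Sigma>. hamming_adj (drop (q * n) w) v \<and> select m w (E v) = t})
    = (real q - 1) * real M * \<rho> t"
proof -
  let ?y = "drop (q * n) w" and ?V = "hamming_words M \<Sigma>"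
  let ?b = "E ?y mod q"
  have y: "?y \<in> ?V" using w by (rule tail_in_hamming_words)
  have finV: "finite ?V" using fin by (rule finite_hamming_words)
  let ?A = "{v \<in> ?V. hamming_adj ?y v \<and> select m w (E v) = t}"
  have "card ?A = (\<Sum>v\<in>?A. 1)"
    by simp
  \<comment> \<open>Group the neighbouring tails by their color \<open>e\<close>. The quotient
    matrix of \<open>E\<close> allows exactly one for each \<open>e\<close> in another class mod
    \<open>q\<close>, and none otherwise.\<close>
  also have "\<dots> = (\<Sum>e\<in>{..<M * q}. \<Sum>v | v \<in> ?A \<and> E v = e. 1)"
    using finV E_image by (intro sum.group[symmetric]) auto
  also have "\<dots> = (\<Sum>e<M * q. if select m w e = t \<and> e mod q \<noteq> ?b then 1 else 0)"
  proof (intro sum.cong refl)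
    fix e assume e: "e \<in> {..<M * q}"
    show "(\<Sum>v | v \<in> ?A \<and> E v = e. 1::nat) = (if select m w e = t \<and> e mod q \<noteq> ?b then 1 else 0)"
    proof (cases "select m w e = t")
      case True
      then have "{v. v \<in> ?A \<and> E v = e} = {v \<in> ?V. hamming_adj ?y v \<and> E v = e}" by auto
      then show ?thesis using True E_neighbours[OF y, of e] e by auto
    next
      case False
      then have "{v. v \<in> ?A \<and> E v = e} = {}" by auto
      then show ?thesis using False by (simp only: sum.empty) simp
    qed
  qed
  finally have "real (card ?A) = (\<Sum>e<M * q. if select m w e = t \<and> e mod q \<noteq> ?b then 1 else 0)"
    by (simp only: of_nat_sum if_distrib[of real] of_nat_0 of_nat_1)
  also have "\<dots> = (\<Sum>a<M. \<Sum>b<q. if C ((m + a) mod M) (block n w b) = t \<and> b \<noteq> ?b then 1 else 0)"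
  proof -
    have "(a * q + b) div q = a \<and> (a * q + b) mod q = b" if "b < q" for a b
      using that by simp
    then show ?thesis
      by (simp add: sum_lessThan_mult select_def)
  qed
  also have "\<dots> = (\<Sum>b<q. \<Sum>a<M. if C ((m + a) mod M) (block n w b) = t \<and> b \<noteq> ?b then 1 else 0)"
    by (rule sum.swap)
  \<comment> \<open>For a fixed block, the shift \<open>a\<close> applies every coloring of the
    collection once to the same word, so uniformity gives the inner sum. Only the
    \<open>q - 1\<close> blocks other than \<open>?b\<close> are reached.\<close>
  also have "\<dots> = (\<Sum>b<q. if b \<noteq> ?b then real M * \<rho> t else 0)"
  proof (intro sum.cong refl)
    fix b assume "b \<in> {..<q}"
    then show "(\<Sum>a<M. if C ((m + a) mod M) (block n w b) = t \<and> b \<noteq> ?b then 1 else 0)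
        = (if b \<noteq> ?b then real M * \<rho> t else 0)"
      using uniform_count_shift[OF block_in_hamming_words[OF w], of b m t] by (cases "b = ?b") simp_all
  qed
  also have "\<dots> = (real q - 1) * real M * \<rho> t"
  proof -
    have "{..<q} \<inter> {b. b \<noteq> ?b} = {..<q} - {?b}" by auto
    then show ?thesis
      using q E_mod_less by (simp add: sum.If_cases of_nat_diff)
  qed
  finally show ?thesis .
qed

text \<open>The tail is untouched, so the selected block and coloring stay the same.\<close>

lemma switched_update_block:
  assumes "w \<in> hamming_words (q * n + M) \<Sigma>" "b < q" "i < n"
  shows "switched m (w[b * n + i := c]) =
    (let e = E (drop (q * n) w) in
      if b = e mod q then C ((m + e div q) mod M) ((block n w b)[i := c]) else switched m w)"
proof -
  have "drop (q * n) (w[b * n + i := c]) = drop (q * n) w"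
    using digits_bound[OF assms(2,3)] by simp
  then show ?thesis
    using assms E_mod_less
    by (auto simp: switched_def select_def Let_def block_update[of _ q] length_hamming_words)
qed

lemma switched_update_tail:
  "switched m (w[q * n + i := c]) = select m w (E ((drop (q * n) w)[i := c]))"
  using E_mod_less by (simp add: switched_def select_def block_update_tail drop_update_swap)

lemma switched_neighbours:
  assumes w: "w \<in> hamming_words (q * n + M) \<Sigma>" and t: "t \<in> K"
  shows "real (card {w' \<in> hamming_words (q * n + M) \<Sigma>. hamming_adj w w' \<and> switched m w' = t})
    = S (switched m w) t + (real q - 1)^2 * real n * (if switched m w = t then 1 else 0)
      + (real q - 1) * real M * \<rho> t"
proof -
  let ?e = "E (drop (q * n) w)"
  let ?b = "?e mod q" and ?k = "(m + ?e div q) mod M"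
  let ?N = "\<lambda>j. real (card {c \<in> \<Sigma>. c \<noteq> w ! j \<and> switched m (w[j := c]) = t})"
  have len: "length w = q * n + M" using w by (rule length_hamming_words)
  \<comment> \<open>While only this block changes, the color is that of the fixed coloring
    \<open>C ?k\<close>; the sum over positions is thus a neighbour count in
    \<open>H(n,q)\<close>.\<close>
  have selected: "(\<Sum>i<n. ?N (?b * n + i)) = S (switched m w) t"
  proof -
    have x: "block n w ?b \<in> hamming_words n \<Sigma>"
      using w E_mod_less by (rule block_in_hamming_words)
    have "(\<Sum>i<n. ?N (?b * n + i))
        = (\<Sum>i<n. real (card {c \<in> \<Sigma>. c \<noteq> block n w ?b ! i \<and> C ?k ((block n w ?b)[i := c]) = t}))"
      using w E_mod_less len
      by (intro sum.cong refl) (simp add: switched_update_block nth_block[of _ q] Let_def)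
    also have "\<dots> = real (card {v \<in> hamming_words n \<Sigma>. hamming_adj (block n w ?b) v \<and> C ?k v = t})"
      by (simp add: card_hamming_neighbours[OF x fin])
    also have "\<dots> = S (switched m w) t"
      using C_neighbours[OF shift_less x t] by (simp add: switched_def select_def)
    finally show ?thesis .
  qed
  \<comment> \<open>Each position of an unselected block admits \<open>q - 1\<close> new letters,
    all keeping the color. The second factor \<open>q - 1\<close> in the square is the number of
    such blocks.\<close>
  have other: "(\<Sum>i<n. ?N (b * n + i)) = (real q - 1) * real n * (if switched m w = t then 1 else 0)"
    if b: "b \<in> {..<q} - {?b}" for b
  proof -
    have "?N (b * n + i) = (real q - 1) * (if switched m w = t then 1 else 0)" if "i < n" for i
    proof -
      have "w ! (b * n + i) \<in> \<Sigma>"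
        using digits_bound[of b q i n] b that by (intro hamming_words_nth[OF w]) auto
      moreover have "{c \<in> \<Sigma>. c \<noteq> w ! (b * n + i)} = \<Sigma> - {w ! (b * n + i)}" by auto
      ultimately show ?thesis
        using b w that fin card_\<Sigma> q by (simp add: switched_update_block Let_def of_nat_diff)
    qed
    then show ?thesis by simp
  qed
  have tail: "(\<Sum>i<M. ?N (q * n + i)) = (real q - 1) * real M * \<rho> t"
  proof -
    have y: "drop (q * n) w \<in> hamming_words M \<Sigma>"
      using w by (rule tail_in_hamming_words)
    \<comment> \<open>With the blocks fixed, this is a neighbour count in the tail graph
      \<open>H(M,q)\<close>.\<close>
    have "(\<Sum>i<M. ?N (q * n + i)) = (\<Sum>i<M. real (card {c \<in> \<Sigma>.
        c \<noteq> drop (q * n) w ! i \<and> select m w (E ((drop (q * n) w)[i := c])) = t}))"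
      using len by (simp add: switched_update_tail)
    also have "\<dots> = (real q - 1) * real M * \<rho> t"
      using tail_neighbours[OF w, of m t]
      by (simp add: card_hamming_neighbours[OF y fin, where P = "\<lambda>v. select m w (E v) = t"])
    finally show ?thesis .
  qed
  have "(\<Sum>b<q. \<Sum>i<n. ?N (b * n + i))
      = (\<Sum>i<n. ?N (?b * n + i)) + (\<Sum>b\<in>{..<q} - {?b}. \<Sum>i<n. ?N (b * n + i))"
    using E_mod_less by (intro sum.remove) auto
  also have "\<dots> = S (switched m w) t + (real q - 1)^2 * real n * (if switched m w = t then 1 else 0)"
    using other selected E_mod_less q by (simp add: of_nat_diff power2_eq_square)
  finally have blocks: "(\<Sum>b<q. \<Sum>i<n. ?N (b * n + i))
      = S (switched m w) t + (real q - 1)^2 * real n * (if switched m w = t then 1 else 0)" .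
  have "real (card {w' \<in> hamming_words (q * n + M) \<Sigma>. hamming_adj w w' \<and> switched m w' = t})
      = (\<Sum>j<q * n + M. ?N j)"
    by (simp add: card_hamming_neighbours[OF w fin])
  also have "\<dots> = (\<Sum>b<q. \<Sum>i<n. ?N (b * n + i)) + (\<Sum>i<M. ?N (q * n + i))"
    by (simp only: sum_lessThan_add sum_lessThan_mult)
  finally show ?thesis
    unfolding blocks tail .
qed

section \<open>Color set and uniformity of the switched colorings\<close>

lemma switched_in_K:
  assumes "w \<in> hamming_words (q * n + M) \<Sigma>"
  shows "switched m w \<in> K"
  unfolding switched_def select_def
  by (intro C_in_K shift_less block_in_hamming_words[OF assms] E_mod_less)

lemma switched_image: "switched m ` hamming_words (q * n + M) \<Sigma> = K"
proof (intro subset_antisym subsetI)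
  fix k assume k: "k \<in> K"
  have "0 \<in> {0..<M * q}" using M q by simp
  then obtain y where y: "y \<in> hamming_words M \<Sigma>"
    unfolding E_image[symmetric] by blast
  obtain x where x: "x \<in> hamming_words n \<Sigma>" "C ((m + E y div q) mod M) x = k"
    using C_surj[OF shift_less] k by metis
  obtain w where "w \<in> hamming_words (q * n + M) \<Sigma>" "drop (q * n) w = y"
    "\<And>b. b < q \<Longrightarrow> block n w b = x"
    \<comment> \<open>All blocks are filled with \<open>x\<close>, so it is read whichever block the
      tail selects.\<close>
    by (rule exists_word[of q "\<lambda>_. x" n \<Sigma> y M]) (use x y in auto)
  then show "k \<in> switched m ` hamming_words (q * n + M) \<Sigma>"
    using x(2) E_mod_less by (auto simp: switched_def select_def intro!: image_eqI[of _ _ w])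
qed (auto simp: switched_in_K)

lemma switched_perfect:
  assumes "finite K"
  shows "hamming_perfect_coloring (q * n + M) \<Sigma> K
    (\<lambda>k t. S k t + (real q - 1)^2 * real n * (if k = t then 1 else 0)
      + (real q - 1) * real M * \<rho> t) (switched m)"
  using assms by (simp add: perfect_coloring_def coloring_def switched_image switched_neighbours)

text \<open>The shift merely permutes the collection on the selected block, and uniformity of
  \<open>C\<close> lets an arbitrary reference word \<open>x\<close> replace that block. The right
  side no longer involves \<open>w\<close>.\<close>

lemma switched_multiset:
  assumes "w \<in> hamming_words (q * n + M) \<Sigma>" "x \<in> hamming_words n \<Sigma>"
  shows "{# switched m w. m \<in># mset_set {..<M} #} = {# C m x. m \<in># mset_set {..<M} #}"
proof -
  let ?e = "E (drop (q * n) w)"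
  have rot: "image_mset (\<lambda>m. (?e div q + m) mod M) (mset_set {..<M}) = mset_set {..<M}"
    using bij_betw_rotate[of "?e div q" M]
    by (simp add: image_mset_mset_set bij_betw_def)
  have "{# switched m w. m \<in># mset_set {..<M} #}
      = image_mset (\<lambda>m. C m (block n w (?e mod q)))
          (image_mset (\<lambda>m. (?e div q + m) mod M) (mset_set {..<M}))"
    by (simp add: multiset.map_comp comp_def switched_def select_def add.commute)
  also have "\<dots> = {# C m x. m \<in># mset_set {..<M} #}"
    unfolding rot
    using U block_in_hamming_words[OF assms(1) E_mod_less] assms(2)
    unfolding uniform_collection_def by blast
  finally show ?thesis .
qed

lemma switched_uniform: "uniform_collection (hamming_words (q * n + M) \<Sigma>) M switched"
  unfolding uniform_collection_def
proof (intro ballI)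
  fix w w' assume w: "w \<in> hamming_words (q * n + M) \<Sigma>" and w': "w' \<in> hamming_words (q * n + M) \<Sigma>"
  have "block n w 0 \<in> hamming_words n \<Sigma>"
    using w q by (intro block_in_hamming_words) auto
  then show "{# switched m w. m \<in># mset_set {..<M} #} = {# switched m w'. m \<in># mset_set {..<M} #}"
    using w w' by (simp add: switched_multiset)
qed

section \<open>Essential dependence on blocks and tail\<close>

lemma switched_depends_block:
  assumes dep: "essentially_depends n \<Sigma> (C 0) i" and b: "b < q" and m: "m < M"
  shows "essentially_depends (q * n + M) \<Sigma> (switched m) (b * n + i)"
proof -
  obtain x x' where x: "x \<in> hamming_words n \<Sigma>" "x' \<in> hamming_words n \<Sigma>"
    and d: "differ_only_at i x x'" and ne: "C 0 x \<noteq> C 0 x'"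
    using dep unfolding essentially_depends_def by blast
  note d = differ_only_atD[OF d]
  have i: "i < n" using d(1) x by (simp add: length_hamming_words)
  \<comment> \<open>This shift turns index \<open>m\<close> into 0, so that \<open>C 0\<close> is
    selected. The outer \<open>mod\<close> matters for \<open>m = 0\<close>, where
    \<open>M - m\<close> would not be a valid high digit.\<close>
  define a where "a = (M - m) mod M"
  have a: "a < M" "(m + a) mod M = 0"
    using m by (simp_all add: a_def mod_add_right_eq)
  \<comment> \<open>Since \<open>E\<close> is onto, some tail has the color selecting block
    \<open>b\<close> together with \<open>C 0\<close>.\<close>
  then have "a * q + b \<in> {0..<M * q}"
    using b digits_bound by auto
  then obtain y where y: "y \<in> hamming_words M \<Sigma>" "E y = a * q + b"
    unfolding E_image[symmetric] by auto
  obtain w where w: "w \<in> hamming_words (q * n + M) \<Sigma>" "drop (q * n) w = y"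
    "\<And>b. b < q \<Longrightarrow> block n w b = x"
    by (rule exists_word[of q "\<lambda>_. x" n \<Sigma> y M]) (use x y in auto)
  let ?w' = "w[b * n + i := x' ! i]"
  have E_digits: "E y mod q = b" "E y div q = a"
    using y(2) b by simp_all
  have len: "length w = q * n + M" using w(1) by (rule length_hamming_words)
  have "w ! (b * n + i) = x ! i"
    using nth_block[of b q n w i] b i len w(3) by simp
  then have "differ_only_at (b * n + i) w ?w'"
    using digits_bound[OF b i] d(2) len by (intro differ_only_at_update) auto
  moreover have "?w' \<in> hamming_words (q * n + M) \<Sigma>"
    using w(1) hamming_words_nth[OF x(2) i] by (rule hamming_words_update)
  moreover have "switched m w = C 0 x"
    using w b a E_digits by (simp add: switched_def select_def)
  moreover have "switched m ?w' = C 0 x'"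
    using w b i a E_digits d(3) by (simp add: switched_update_block)
  ultimately show ?thesis
    unfolding essentially_depends_def using w(1) ne by metis
qed

lemma switched_depends_tail:
  assumes k: "k \<in> K" "k' \<in> K" "k \<noteq> k'" and i: "i < M"
  shows "essentially_depends (q * n + M) \<Sigma> (switched m) (q * n + i)"
proof -
  have "0 \<in> {0..<M * q}" using M q by simp
  then obtain y where y: "y \<in> hamming_words M \<Sigma>"
    unfolding E_image[symmetric] by blast
  have "card (\<Sigma> - {y ! i}) > 0"
    using card_\<Sigma> q hamming_words_nth[OF y i] fin by simp
  then obtain c where c: "c \<in> \<Sigma>" "c \<noteq> y ! i"
    by (auto simp: card_gt_0_iff)
  let ?y' = "y[i := c]"
  have y': "?y' \<in> hamming_words M \<Sigma>"
    using y c(1) by (rule hamming_words_update)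
  have diff: "differ_only_at i y ?y'"
    using y c i by (intro differ_only_at_update) (auto simp: length_hamming_words)
  let ?b = "E y mod q" and ?b' = "E ?y' mod q"
  have "E ?y' < M * q" using E_image y' by auto
  \<comment> \<open>The changed tail is itself a neighbour with its color, so the corresponding
    entry for \<open>E\<close> is nonzero and the residues mod \<open>q\<close> differ.\<close>
  moreover have "card {v \<in> hamming_words M \<Sigma>. hamming_adj y v \<and> E v = E ?y'} > 0"
    using diff y' fin finite_hamming_words[OF fin, of M] by (auto simp: card_gt_0_iff hamming_adj_def)
  ultimately have b: "?b \<noteq> ?b'"
    using E_neighbours[OF y, of "E ?y'"] by auto
  \<comment> \<open>The step may change the selected coloring too. Each coloring is onto
    \<open>K\<close>, so \<open>x\<close> is chosen for the one selected before the step and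
    \<open>x'\<close> for the one after it.\<close>
  obtain x where x: "x \<in> hamming_words n \<Sigma>" "C ((m + E y div q) mod M) x = k"
    using C_surj[OF shift_less] k by metis
  obtain x' where x': "x' \<in> hamming_words n \<Sigma>" "C ((m + E ?y' div q) mod M) x' = k'"
    using C_surj[OF shift_less] k by metis
  \<comment> \<open>As \<open>?b'\<close> differs from \<open>?b\<close>, the block read after the
    step contains \<open>x'\<close>.\<close>
  obtain w where w: "w \<in> hamming_words (q * n + M) \<Sigma>" "drop (q * n) w = y"
    "\<And>b. b < q \<Longrightarrow> block n w b = (if b = ?b then x else x')"
    by (rule exists_word[of q "\<lambda>b. if b = ?b then x else x'" n \<Sigma> y M]) (use x x' y in auto)
  let ?w' = "w[q * n + i := c]"
  have len: "length w = q * n + M" using w(1) by (rule length_hamming_words)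
  have "w ! (q * n + i) = y ! i"
    using w(2) len by auto
  then have "differ_only_at (q * n + i) w ?w'"
    using len i c by (intro differ_only_at_update) auto
  moreover have "?w' \<in> hamming_words (q * n + M) \<Sigma>"
    using w(1) c(1) by (rule hamming_words_update)
  moreover have "switched m w = k"
    using w x E_mod_less by (simp add: switched_def select_def)
  moreover have "switched m ?w' = k'"
    using w x' b E_mod_less by (simp add: switched_update_tail select_def)
  ultimately show ?thesis
    unfolding essentially_depends_def using w(1) k(3) by metis
qed

end

theorem theorem1:
  fixes n q M r :: nat
    and \<Sigma> :: "'a set"
    and K :: "'c set"
    and S :: "'c \<Rightarrow> 'c \<Rightarrow> real"
    and C :: "nat \<Rightarrow> 'a list \<Rightarrow> 'c"
    and E :: "'a list \<Rightarrow> nat"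
  assumes "n \<ge> 1" and "q \<ge> 2" and "M \<ge> 1" and "r \<ge> 1"
    and "finite \<Sigma>" and "card \<Sigma> = q"
    and "finite K" and "card K = r"
    and "\<forall>m<M. hamming_perfect_coloring n \<Sigma> K S (C m)"
    and "uniform_collection (hamming_words n \<Sigma>) M C"
    and "\<forall>i<n. essentially_depends n \<Sigma> (C 0) i"
    and "hamming_perfect_coloring M \<Sigma> {0..<M * q}
           (\<lambda>i j. if i mod q = j mod q then 0 else 1) E"
  shows "\<exists>D :: nat \<Rightarrow> 'a list \<Rightarrow> 'c.
           (\<forall>m<M. hamming_perfect_coloring (q * n + M) \<Sigma> K
              (\<lambda>k t. S k t
                 + (real q - 1)^2 * real n * (if k = t then 1 else 0)
                 + (real q - 1) * real M
                     * density_vector (hamming_words n \<Sigma>) hamming_adj K S t)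
              (D m)) \<and>
           uniform_collection (hamming_words (q * n + M) \<Sigma>) M D \<and>
           (\<forall>m<M. \<forall>i<q * n + M. essentially_depends (q * n + M) \<Sigma> (D m) i)"
proof -
  interpret coloring_switch n q M \<Sigma> K S C E
    using assms by unfold_locales auto
  \<comment> \<open>As \<open>n \<ge> 1\<close>, dependence on argument 0 provides two distinct
    colors in \<open>K\<close>, which dependence on the tail requires.\<close>
  have "essentially_depends n \<Sigma> (C 0) 0"
    using assms(1,11) by simp
  then obtain x x' where "x \<in> hamming_words n \<Sigma>" "x' \<in> hamming_words n \<Sigma>" "C 0 x \<noteq> C 0 x'"
    unfolding essentially_depends_def by blast
  then have K: "C 0 x \<in> K" "C 0 x' \<in> K" "C 0 x \<noteq> C 0 x'"
    using C_in_K[of 0] assms(3) by auto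
  have "essentially_depends (q * n + M) \<Sigma> (switched m) j" if m: "m < M" and j: "j < q * n + M" for m j
  proof (cases "j < q * n")
    case True
    \<comment> \<open>The digits of \<open>j\<close> are its block and its place within the
      block.\<close>
    then have "j div n < q" "j mod n < n"
      using assms(1) by (auto simp: less_mult_imp_div_less)
    then have "essentially_depends (q * n + M) \<Sigma> (switched m) (j div n * n + j mod n)"
      using assms(11) m by (intro switched_depends_block) auto
    then show ?thesis by simp
  next
    case False
    then have "essentially_depends (q * n + M) \<Sigma> (switched m) (q * n + (j - q * n))"
      using K j by (intro switched_depends_tail) auto
    then show ?thesis using False by simp
  qed
  then show ?thesis
    using switched_perfect[OF assms(7)] switched_uniform by (intro exI[of _ switched]) blast
qed

end
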